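(* For every odd integer $n\geq 3$, every integer $t$ with $3\le t\le n$, and every nonnegative integer $l$, there exists an SFD$(t,n)$ whose set of entries is $\{1+l,2+l,\dots,nt+l\}$.
   Context: For an integer $a$ and a positive integer $n$, $\langle a\rangle_n$ denotes the unique element of $\{1,\dots,n\}$ congruent to $a$ modulo $n$. For a $t\times n$ array $A=(a_{i,j})$, the forward diagonals are, for each $j\in\{1,\dots,n\}$, the sets of entries $\{a_{i,\langle j+i\rangle_n}: i=1,\dots,t\}$. A $t\times n$ array $A=(a_{i,j})$ with $t\le n$ is a symmetric forward diagonals array, SFD$(t,n)$, if: (1) its entries are $nt$ consecutive positive integers (each occurring once); (2) all columns have the same sum; (3) all forward diagonals have the same sum; (4) $a_{i,j}+a_{t+1-i,n+1-j}$ is a constant independent of $(i,j)$. *)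

theory Defs
  imports "HOL-Number_Theory.Cong"
begin

definition pos_residue :: "int \<Rightarrow> nat \<Rightarrow> nat" where
  "pos_residue a n = (THE r. r \<in> {1..n} \<and> [int r = a] (mod int n))"

lemma pos_residue_eq:
  assumes "n > 0"
  shows "pos_residue a n = nat ((a - 1) mod int n) + 1"
  unfolding pos_residue_def
proof (rule the_equality)
  let ?r = "nat ((a - 1) mod int n) + 1"
  have b: "0 \<le> (a - 1) mod int n" "(a - 1) mod int n < int n"
    using assms by simp_all
  have r: "int ?r = (a - 1) mod int n + 1" using b by simp
  have "int ?r mod int n = a mod int n"
    unfolding r by (simp add: mod_add_left_eq)
  moreover have "?r \<in> {1..n}" using b by auto
  ultimately show "?r \<in> {1..n} \<and> [int ?r = a] (mod int n)"
    by (simp add: cong_def)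
next
  fix r assume r: "r \<in> {1..n} \<and> [int r = a] (mod int n)"
  then have "[int r - 1 = a - 1] (mod int n)" by (intro cong_diff) auto
  then have "(int r - 1) mod int n = (a - 1) mod int n" by (simp add: cong_def)
  moreover have "(int r - 1) mod int n = int r - 1" using r by auto
  ultimately show "r = nat ((a - 1) mod int n) + 1" using r by auto
qed

text \<open>A \<open>t \<times> n\<close> array is a function \<open>A\<close> of a row index in \<open>{1..t}\<close> and a column
  index in \<open>{1..n}\<close>; its values at other indices are irrelevant.\<close>

definition entries :: "nat \<Rightarrow> nat \<Rightarrow> (nat \<Rightarrow> nat \<Rightarrow> nat) \<Rightarrow> nat set" where
  "entries t n A = {A i j | i j. i \<in> {1..t} \<and> j \<in> {1..n}}"

definition column_sum :: "nat \<Rightarrow> (nat \<Rightarrow> nat \<Rightarrow> nat) \<Rightarrow> nat \<Rightarrow> nat" where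
  "column_sum t A j = (\<Sum>i = 1..t. A i j)"

definition forward_diagonal_sum ::
    "nat \<Rightarrow> nat \<Rightarrow> (nat \<Rightarrow> nat \<Rightarrow> nat) \<Rightarrow> nat \<Rightarrow> nat" where
  "forward_diagonal_sum t n A j = (\<Sum>i = 1..t. A i (pos_residue (int j + int i) n))"

text \<open>In the symmetry condition \<open>i \<le> t\<close> and \<open>j \<le> n\<close>, so the subtractions on
  \<^typ>\<open>nat\<close> do not truncate. In the first condition the entries are the \<open>n * t\<close>
  consecutive positive integers following \<open>k\<close>; bijectivity says each occurs once.\<close>

definition SFD :: "nat \<Rightarrow> nat \<Rightarrow> (nat \<Rightarrow> nat \<Rightarrow> nat) \<Rightarrow> bool" where
  "SFD t n A \<longleftrightarrow> t \<le> n \<and>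
     (\<exists>k. bij_betw (\<lambda>(i, j). A i j) ({1..t} \<times> {1..n}) {1 + k..n * t + k}) \<and>
     (\<exists>s. \<forall>j\<in>{1..n}. column_sum t A j = s) \<and>
     (\<exists>s. \<forall>j\<in>{1..n}. forward_diagonal_sum t n A j = s) \<and>
     (\<exists>c. \<forall>i\<in>{1..t}. \<forall>j\<in>{1..n}. A i j + A (t + 1 - i) (n + 1 - j) = c)"

end

theory Submission
  imports Defs
begin

text \<open>
  Write \<open>n = 2m + 1\<close>, number the columns by residues \<open>k\<close> modulo \<open>n\<close> so that the middle column
  is \<open>0\<close>, and let row \<open>i\<close> consist of the \<open>i\<close>-th block of \<open>n\<close> consecutive integers, permuted by a
  function \<open>f\<^sub>i\<close> with values in \<open>{-m..m}\<close>. Then the array is an SFD as soon as the column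
  sums and the diagonal sums of the \<open>f\<^sub>i\<close> vanish and the bottom rows are the point
  reflections of the top ones. If \<open>cent x\<close> is the residue of \<open>x\<close> in \<open>{-m..m}\<close> and \<open>d\<close> is
  \<open>m/2\<close> rounded up, then \<open>cent (x + d) + cent (x - d) = cent (2 x)\<close>, so that
  \<open>cent (2dk + d), cent (-4dk), cent (2dk - d)\<close> is a solution with three rows, and repeating it
  gives six rows. Inserting \<open>cent (4dk), cent (-4dk)\<close> after the middle row gives a solution with five rows.
  Finally, four rows can be wrapped around any solution: two rows \<open>p, -p\<close> on top,
  where \<open>p\<close> is a suitable translate of \<open>cent\<close>, and their reflections at the bottom.
\<close>

section \<open>Sums along columns and diagonals of a list of rows\<close>

fun list_column_sum :: "(int \<Rightarrow> int) list \<Rightarrow> int \<Rightarrow> int" where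
  "list_column_sum [] k = 0"
| "list_column_sum (f # L) k = f k + list_column_sum L k"

text \<open>A diagonal moves one column to the right per row. Columns are arbitrary integers: the
  rows used below are periodic modulo \<open>n\<close>, which takes care of the wrap-around.\<close>

fun list_diagonal_sum :: "(int \<Rightarrow> int) list \<Rightarrow> int \<Rightarrow> int" where
  "list_diagonal_sum [] k = 0"
| "list_diagonal_sum (f # L) k = f k + list_diagonal_sum L (k + 1)"

lemma list_column_sum_append:
  "list_column_sum (L @ M) k = list_column_sum L k + list_column_sum M k"
  by (induction L) auto

lemma list_diagonal_sum_append:
  "list_diagonal_sum (L @ M) k =
    list_diagonal_sum L k + list_diagonal_sum M (k + int (length L))"
  by (induction L arbitrary: k) (auto simp: algebra_simps)

lemma list_column_sum_conv_sum: "list_column_sum L k = (\<Sum>i<length L. (L ! i) k)"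
  by (induction L) (simp_all add: sum.lessThan_Suc_shift del: sum.lessThan_Suc)

lemma list_diagonal_sum_conv_sum:
  "list_diagonal_sum L k = (\<Sum>i<length L. (L ! i) (k + int i))"
  by (induction L arbitrary: k)
    (simp_all add: sum.lessThan_Suc_shift algebra_simps del: sum.lessThan_Suc)

text \<open>Effect of the point reflection on one row: with columns and values both centred at 0, it
  negates both.\<close>

definition reflect :: "(int \<Rightarrow> int) \<Rightarrow> int \<Rightarrow> int" where
  "reflect f = (\<lambda>k. - f (- k))"

lemma reflect_reflect [simp]: "reflect (reflect f) = f"
  by (simp add: reflect_def)

section \<open>Centred residues modulo an odd number\<close>

locale odd_modulus =
  fixes m n :: int
  assumes m_pos: "m \<ge> 1" and n_def: "n = 2 * m + 1"
begin

definition cent :: "int \<Rightarrow> int" where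
  "cent x = (x + m) mod n - m"

lemma cent_bounds: "- m \<le> cent x" "cent x \<le> m"
proof -
  have "n > 0" using m_pos n_def by simp
  then have "0 \<le> (x + m) mod n" "(x + m) mod n < n" by simp_all
  then show "- m \<le> cent x" "cent x \<le> m"
    using n_def unfolding cent_def by linarith+
qed

lemma cent_eq_iff: "cent x = cent y \<longleftrightarrow> [x = y] (mod n)"
proof -
  have "cent x = cent y \<longleftrightarrow> [x + m = y + m] (mod n)"
    by (simp add: cent_def cong_def)
  also have "\<dots> \<longleftrightarrow> [x = y] (mod n)"
    by (rule cong_add_rcancel)
  finally show ?thesis .
qed

lemma cent_eqI: "cent x = cent y" if "y = x + q * n"
  using that by (simp add: cent_eq_iff cong_iff_lin)

lemma cent_id: "cent x = x" if "- m \<le> x" "x \<le> m"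
  using that unfolding cent_def by (subst mod_pos_pos_trivial) (simp_all add: n_def)

lemma cent_decomp: "\<exists>q. x = cent x + q * n"
proof -
  have "x = cent x + ((x + m) div n) * n"
    by (simp add: cent_def algebra_simps flip: minus_mod_eq_div_mult)
  then show ?thesis ..
qed

text \<open>On these three periods \<open>cent\<close> is piecewise linear, which turns the
  identities below into linear arithmetic.\<close>

lemma cent_near:
  assumes "- m - n \<le> x" "x \<le> m + n"
  shows "cent x = (if x < - m then x + n else if x \<le> m then x else x - n)"
proof -
  have "cent x = cent (x + n)" by (rule cent_eqI[where q = 1]) simp
  moreover have "cent x = cent (x - n)" by (rule cent_eqI[where q = "-1"]) simp
  moreover have "x < - m \<Longrightarrow> cent (x + n) = x + n" using assms n_def by (intro cent_id) auto
  moreover have "x > m \<Longrightarrow> cent (x - n) = x - n" using assms n_def by (intro cent_id) auto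
  ultimately show ?thesis using cent_id[of x] by auto
qed

lemma cent_uminus: "cent (- x) = - cent x"
proof -
  obtain q where q: "x = cent x + q * n" using cent_decomp by blast
  have "cent (- x) = cent (- cent x)"
    by (rule cent_eqI[where q = q]) (subst q, simp add: algebra_simps)
  also have "\<dots> = - cent x" using cent_bounds[of x] by (intro cent_id) auto
  finally show ?thesis .
qed

section \<open>Rows, solutions, and ways to enlarge a solution\<close>

definition is_row :: "(int \<Rightarrow> int) \<Rightarrow> bool" where
  "is_row f \<longleftrightarrow> range f \<subseteq> {- m..m} \<and> (\<forall>x y. f x = f y \<longleftrightarrow> [x = y] (mod n))"

lemma is_row_affine: "is_row (\<lambda>k. cent (a * k + c))" if "coprime a n"
  using that cent_bounds
  by (auto simp: is_row_def cent_eq_iff cong_add_rcancel cong_mult_lcancel)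

lemma is_row_uminus: "is_row (\<lambda>k. - f k)" if "is_row f"
  using that by (auto simp: is_row_def image_subset_iff minus_le_iff)

lemma is_row_reflect: "is_row (reflect f)" if "is_row f"
  using that
  by (auto simp: is_row_def reflect_def image_subset_iff minus_le_iff cong_minus_minus_iff)

text \<open>The last conjunct is the symmetry condition of an SFD: reflecting each row reverses the
  order of the rows.\<close>

definition solution :: "(int \<Rightarrow> int) list \<Rightarrow> bool" where
  "solution L \<longleftrightarrow> (\<forall>f\<in>set L. is_row f) \<and> (\<forall>k. list_column_sum L k = 0) \<and>
    (\<forall>k. list_diagonal_sum L k = 0) \<and> map reflect L = rev L"

lemma solution_twice: "solution (L @ L)" if "solution L"
  using that by (auto simp: solution_def list_column_sum_append list_diagonal_sum_append)

lemma solution_wrap: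
  assumes L: "solution L"
  shows "\<exists>M. solution M \<and> length M = length L + 4"
proof -
  define s where "s = int (length L)"
  \<comment> \<open>\<open>m + 1\<close> is the inverse of 2, so \<open>2 h = - 3 - s\<close> modulo \<open>n\<close>: this aligns the jump of
    \<open>p\<close> with that of its reflection.\<close>
  define h where "h = (m + 1) * (- 3 - s)"
  define p where "p k = cent (1 * k + (m - h))" for k
  define q where "q k = - p k" for k
  let ?M = "[p, q] @ L @ [reflect q, reflect p]"
  have p: "is_row p"
    unfolding p_def[abs_def] by (rule is_row_affine) simp
  have q: "is_row q"
    unfolding q_def[abs_def] using p by (rule is_row_uminus)
  \<comment> \<open>This is what the four new rows add to a diagonal sum. By the choice of
    \<open>h\<close>, \<open>p\<close> is antisymmetric: \<open>p (- k - s - 2) = - p k\<close>.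
    Using this at \<open>k\<close> and at \<open>k + 1\<close> cancels all four terms.\<close>
  have diag: "p k - p (k + 1) + p (- k - s - 2) - p (- k - s - 3) = 0" for k
  proof -
    have "p (- k - s - 2) = cent (- (1 * k + (m - h)))"
      unfolding p_def by (rule cent_eqI[where q = "- s - 4"]) (simp add: h_def n_def algebra_simps)
    moreover have "p (- k - s - 3) = cent (- (1 * (k + 1) + (m - h)))"
      unfolding p_def by (rule cent_eqI[where q = "- s - 4"]) (simp add: h_def n_def algebra_simps)
    ultimately show ?thesis by (simp only: cent_uminus p_def)
  qed
  have "solution ?M"
    using L p q is_row_reflect[OF p] is_row_reflect[OF q] diag
    by (auto simp: solution_def list_column_sum_append list_diagonal_sum_append
        reflect_def q_def s_def algebra_simps)
  moreover have "length ?M = length L + 4" by simp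
  ultimately show ?thesis by blast
qed

section \<open>Solutions with three and five rows, and the induction on the number of rows\<close>

definition d :: int where
  "d = (m + 1) div 2"

lemma d_cases:
  obtains "m = 2 * d" | "m = 2 * d - 1"
proof -
  have "m = 2 * d \<or> m = 2 * d - 1" unfolding d_def by presburger
  then show ?thesis using that by blast
qed

text \<open>\<open>4 * d\<close> is \<open>n - 1\<close> or \<open>n + 1\<close>, depending on the
  parity of \<open>m\<close>.\<close>

lemma coprime_d: "coprime (2 * d) n" "coprime (4 * d) n"
proof -
  have "coprime (4 * d) n"
  proof (rule d_cases)
    assume "m = 2 * d"
    then have "n = 4 * d + 1" by (simp add: n_def)
    then show ?thesis by (metis coprime_1_right coprime_add_one_right)
  next
    assume "m = 2 * d - 1"
    then have "4 * d = n + 1" by (simp add: n_def)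
    then show ?thesis by (metis coprime_add_one_left)
  qed
  moreover have "2 * d dvd 4 * d" by (intro dvdI[where k = 2]) simp
  ultimately show "coprime (2 * d) n" "coprime (4 * d) n"
    using coprime_divisors[of "2 * d" "4 * d" n n] by auto
qed

text \<open>For a centred residue \<open>y\<close>, both sides are \<open>2 * y\<close> up to a
  multiple of \<open>n\<close>. Because \<open>d\<close> is \<open>m / 2\<close> rounded up,
  \<open>y + d > m\<close> holds exactly when \<open>2 * y > m\<close>, and symmetrically below
  \<open>- m\<close>, so both sides wrap around together.\<close>

lemma cent_triple: "cent (x + d) + cent (x - d) = cent (2 * x)"
proof -
  define y where "y = cent x"
  obtain q where q: "x = y + q * n" using cent_decomp y_def by blast
  have y: "- m \<le> y" "y \<le> m" using cent_bounds by (auto simp: y_def)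
  have eqs: "cent (x + d) = cent (y + d)" "cent (x - d) = cent (y - d)"
    "cent (2 * x) = cent (2 * y)"
    by (intro cent_eqI[where q = "- q"] cent_eqI[where q = "- (2 * q)"];
        simp add: q algebra_simps)+
  have "cent (y + d) + cent (y - d) = cent (2 * y)"
  proof -
    note near = cent_near[of "y + d"] cent_near[of "y - d"] cent_near[of "2 * y"]
    show ?thesis
      by (rule d_cases) (use near y m_pos n_def in \<open>smt (verit)\<close>)+
  qed
  then show ?thesis by (simp add: eqs)
qed

text \<open>This is the diagonal condition for five rows, seen from the column of the middle
  row.\<close>

lemma cent_quintuple:
  "cent (x + 3 * d) + cent (x - 3 * d) + cent (2 * x) = cent (2 * x + 4 * d) + cent (2 * x - 4 * d)"
proof -
  define y where "y = cent x"
  obtain q where q: "x = y + q * n" using cent_decomp y_def by blast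
  have y: "- m \<le> y" "y \<le> m" using cent_bounds by (auto simp: y_def)
  have eqs: "cent (x + 3 * d) = cent (y + 3 * d)" "cent (x - 3 * d) = cent (y - 3 * d)"
    "cent (2 * x) = cent (2 * y)"
    by (intro cent_eqI[where q = "- q"] cent_eqI[where q = "- (2 * q)"];
        simp add: q algebra_simps)+
  \<comment> \<open>Modulo \<open>n\<close>, \<open>4 * d\<close> is -1 or 1; the sign only decides
    the order of the two summands.\<close>
  have "cent (2 * x + 4 * d) + cent (2 * x - 4 * d) = cent (2 * y + 1) + cent (2 * y - 1)"
  proof (rule d_cases)
    assume "m = 2 * d"
    then have n: "n = 4 * d + 1" by (simp add: n_def)
    have "cent (2 * x + 4 * d) = cent (2 * y - 1)"
      by (rule cent_eqI[where q = "- 2 * q - 1"]) (simp add: q n algebra_simps)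
    moreover have "cent (2 * x - 4 * d) = cent (2 * y + 1)"
      by (rule cent_eqI[where q = "- 2 * q + 1"]) (simp add: q n algebra_simps)
    ultimately show ?thesis by simp
  next
    assume "m = 2 * d - 1"
    then have n: "n = 4 * d - 1" by (simp add: n_def)
    have "cent (2 * x + 4 * d) = cent (2 * y + 1)"
      by (rule cent_eqI[where q = "- 2 * q - 1"]) (simp add: q n algebra_simps)
    moreover have "cent (2 * x - 4 * d) = cent (2 * y - 1)"
      by (rule cent_eqI[where q = "- 2 * q + 1"]) (simp add: q n algebra_simps)
    ultimately show ?thesis by simp
  qed
  moreover have "cent (y + 3 * d) + cent (y - 3 * d) + cent (2 * y)
      = cent (2 * y + 1) + cent (2 * y - 1)"
  proof -
    note near = cent_near[of "y + 3 * d"] cent_near[of "y - 3 * d"] cent_near[of "2 * y"]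
      cent_near[of "2 * y + 1"] cent_near[of "2 * y - 1"]
    show ?thesis
      by (rule d_cases) (use near y m_pos n_def in \<open>smt (verit)\<close>)+
  qed
  ultimately show ?thesis by (simp add: eqs)
qed

definition outer_row :: "int \<Rightarrow> int" where
  "outer_row k = cent (2 * d * k + d)"

text \<open>The term \<open>+ 0\<close> gives the body the shape required by
  \<open>is_row_affine\<close>.\<close>

definition inner_row :: "int \<Rightarrow> int" where
  "inner_row k = cent (- 4 * d * k + 0)"

lemma is_row_outer: "is_row outer_row"
  unfolding outer_row_def[abs_def] by (rule is_row_affine) (rule coprime_d)

lemma is_row_inner: "is_row inner_row"
  unfolding inner_row_def[abs_def] by (rule is_row_affine) (use coprime_d(2) in simp)

lemma inner_row_minus: "inner_row (- k) = - inner_row k"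
  by (simp add: inner_row_def flip: cent_uminus)

lemma reflect_inner_row [simp]: "reflect inner_row = inner_row"
  by (simp add: reflect_def inner_row_minus)

lemma reflect_outer_row: "reflect outer_row k = cent (2 * d * k - d)"
  by (simp add: reflect_def outer_row_def flip: cent_uminus)

lemma column_triple: "outer_row k + (inner_row k + reflect outer_row k) = 0"
proof -
  have "inner_row k = - cent (2 * (2 * d * k))"
    by (simp add: inner_row_def mult.assoc flip: cent_uminus)
  then show ?thesis
    using cent_triple[of "2 * d * k"] by (simp add: outer_row_def reflect_outer_row)
qed

lemma solution_3: "solution [outer_row, inner_row, reflect outer_row]"
proof -
  have "outer_row k + (inner_row (k + 1) + reflect outer_row (k + 2)) = 0" for k
  proof -
    \<comment> \<open>Seen from the middle row, the outer rows are again at distance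
      \<open>d\<close> from \<open>y\<close>, with signs exchanged, so \<open>cent_triple\<close>
      serves for diagonals as well as for columns.\<close>
    define y where "y = 2 * d * (k + 1)"
    have "inner_row (k + 1) = - cent (2 * y)"
      by (simp add: inner_row_def y_def mult.assoc flip: cent_uminus)
    moreover have "outer_row k = cent (y - d)"
      by (simp add: outer_row_def y_def algebra_simps)
    moreover have "reflect outer_row (k + 2) = cent (y + d)"
      by (simp add: reflect_outer_row y_def algebra_simps)
    ultimately show ?thesis using cent_triple[of y] by simp
  qed
  then show ?thesis
    using column_triple
    by (auto simp: solution_def is_row_outer is_row_inner is_row_reflect add.assoc)
qed

lemma solution_5:
  "solution [outer_row, inner_row, \<lambda>k. - inner_row k, inner_row, reflect outer_row]"
proof -
  have "outer_row k + (inner_row (k + 1)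
      + (inner_row (k + 3) + reflect outer_row (k + 4) - inner_row (k + 2))) = 0" for k
  proof -
    define y where "y = 2 * d * (k + 2)"
    have "outer_row k = cent (y - 3 * d)"
      by (simp add: outer_row_def y_def algebra_simps)
    moreover have "inner_row (k + 1) = - cent (2 * y - 4 * d)"
      by (simp add: inner_row_def y_def algebra_simps flip: cent_uminus)
    moreover have "inner_row (k + 2) = - cent (2 * y)"
      by (simp add: inner_row_def y_def algebra_simps flip: cent_uminus)
    moreover have "inner_row (k + 3) = - cent (2 * y + 4 * d)"
      by (simp add: inner_row_def y_def algebra_simps flip: cent_uminus)
    moreover have "reflect outer_row (k + 4) = cent (y + 3 * d)"
      by (simp add: reflect_outer_row y_def algebra_simps)
    ultimately show ?thesis using cent_quintuple[of y] by simp
  qed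
  moreover have "reflect (\<lambda>k. - inner_row k) = (\<lambda>k. - inner_row k)"
    by (simp add: reflect_def inner_row_minus)
  ultimately show ?thesis
    using column_triple
    by (auto simp: solution_def is_row_outer is_row_inner is_row_reflect is_row_uminus
        add.assoc)
qed

text \<open>Wrapping adds four rows, so one starting length is needed in each residue class modulo
  4: 3, 4, 5 and 6. Length 4 wraps the empty list.\<close>

lemma solution_exists: "\<exists>L. solution L \<and> length L = t" if "t \<ge> 3"
  using that
proof (induction t rule: less_induct)
  case (less t)
  consider "t = 3" | "t = 4" | "t = 5" | "t = 6" | "t - 4 \<ge> 3"
    using less.prems by linarith
  then show ?case
  proof cases
    case 1
    then show ?thesis using solution_3 by fastforce
  next
    case 2
    have "solution []" by (simp add: solution_def)
    then show ?thesis using solution_wrap[of "[]"] 2 by simp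
  next
    case 3
    then show ?thesis using solution_5 by fastforce
  next
    case 4
    then show ?thesis using solution_twice[OF solution_3] by fastforce
  next
    case 5
    then obtain L where "solution L" "length L = t - 4" using less.IH[of "t - 4"] by auto
    then show ?thesis using solution_wrap[of L] 5 by simp
  qed
qed

end

section \<open>From solutions to arrays of consecutive integers\<close>

lemma pos_residue_props:
  assumes "n > 0"
  shows "pos_residue a n \<in> {1..n}" "[int (pos_residue a n) = a] (mod int n)"
proof -
  have b: "0 \<le> (a - 1) mod int n" "(a - 1) mod int n < int n"
    using assms by simp_all
  then show "pos_residue a n \<in> {1..n}"
    unfolding pos_residue_eq[OF assms] by (simp only: atLeastAtMost_iff) linarith
  show "[int (pos_residue a n) = a] (mod int n)"
    using b mod_add_left_eq[of "a - 1" "int n" 1]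
    by (simp add: pos_residue_eq[OF assms] cong_def add.commute)
qed

text \<open>Once positions are lowered by 1, quotient and remainder by \<open>n\<close> recover the
  row and the position in its block, which gives injectivity. Surjectivity follows by
  counting.\<close>

lemma bij_betw_row_blocks:
  fixes u :: "nat \<Rightarrow> nat \<Rightarrow> nat"
  assumes u: "\<And>i j. i \<in> {1..t} \<Longrightarrow> j \<in> {1..n} \<Longrightarrow> u i j \<in> {1..n}"
    and inj: "\<And>i. i \<in> {1..t} \<Longrightarrow> inj_on (u i) {1..n}"
  shows "bij_betw (\<lambda>(i, j). l + n * (i - 1) + u i j) ({1..t} \<times> {1..n}) {1 + l..n * t + l}"
    (is "bij_betw ?A ?I ?E")
proof -
  have div: "(n * a + (x - 1)) div n = a" "(n * a + (x - 1)) mod n = x - 1"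
    if "x \<in> {1..n}" for a x :: nat
  proof -
    have "x - 1 < n" using that by auto
    then show "(n * a + (x - 1)) div n = a" "(n * a + (x - 1)) mod n = x - 1" by simp_all
  qed
  have inj_A: "inj_on ?A ?I"
  proof (rule inj_onI, clarsimp)
    fix i j i' j'
    assume *: "Suc 0 \<le> i" "i \<le> t" "Suc 0 \<le> j" "j \<le> n" "Suc 0 \<le> i'" "i' \<le> t" "Suc 0 \<le> j'" "j' \<le> n"
      and eq: "n * (i - Suc 0) + u i j = n * (i' - Suc 0) + u i' j'"
    have r: "u i j \<in> {1..n}" "u i' j' \<in> {1..n}"
      using u[of i j] u[of i' j'] * by auto
    have eq': "n * (i - 1) + (u i j - 1) = n * (i' - 1) + (u i' j' - 1)"
      using eq r by auto
    have "i - 1 = i' - 1" "u i j - 1 = u i' j' - 1"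
      using div[OF r(1), of "i - 1"] div[OF r(2), of "i' - 1"] unfolding eq' by auto
    then have "i = i'" "u i j = u i' j'" using * r by auto
    then show "i = i' \<and> j = j'" using inj_onD[OF inj[of i], of j j'] * by auto
  qed
  have in_block: "l + n * (i - 1) + u i j \<in> ?E" if *: "i \<in> {1..t}" "j \<in> {1..n}" for i j
  proof -
    have "u i j \<in> {1..n}" using u[of i j] * by auto
    moreover have "n * (i - 1) + n \<le> n * t"
      using * mult_le_mono2[of i t n] by (cases i) auto
    ultimately show ?thesis by auto
  qed
  have sub: "?A ` ?I \<subseteq> ?E"
  proof (rule image_subsetI)
    fix x assume "x \<in> ?I"
    then show "?A x \<in> ?E" using in_block by (cases x) (simp only: mem_Sigma_iff case_prod_conv)
  qed
  have "card (?A ` ?I) = card ?E"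
    unfolding card_image[OF inj_A] by simp
  then have "?A ` ?I = ?E"
    by (intro card_subset_eq sub) simp_all
  with inj_A show ?thesis by (rule bij_betw_imageI)
qed

theorem theorem3p5:
  fixes n t l :: nat
  assumes "odd n" and "n \<ge> 3" and "3 \<le> t" and "t \<le> n"
  shows "\<exists>A. SFD t n A \<and> entries t n A = {1 + l..n * t + l}"
proof -
  obtain h where h: "n = 2 * h + 1" using \<open>odd n\<close> by (elim oddE)
  define m where "m = int h"
  interpret odd_modulus m "int n"
    by unfold_locales (use \<open>n \<ge> 3\<close> h in \<open>auto simp: m_def\<close>)
  obtain L where L: "solution L" and len: "length L = t"
    using solution_exists \<open>3 \<le> t\<close> by blast
  \<comment> \<open>\<open>m + 1\<close> is the middle of \<open>{1..n}\<close>: it centres the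
    column index and moves the values from \<open>{- m..m}\<close> to \<open>{1..n}\<close>.\<close>
  define u where "u i j = nat (m + 1 + (L ! (i - 1)) (int j - (m + 1)))" for i j :: nat
  define A where "A i j = l + n * (i - 1) + u i j" for i j :: nat
  have row: "is_row (L ! (i - 1))" if "i \<in> {1..t}" for i
    using L that len by (auto simp: solution_def)
  have u: "int (u i j) = m + 1 + (L ! (i - 1)) (int j - (m + 1))" "u i j \<in> {1..n}"
    if "i \<in> {1..t}" for i j
  proof -
    have "(L ! (i - 1)) (int j - (m + 1)) \<in> {- m..m}"
      using row[OF that] unfolding is_row_def by blast
    then show "int (u i j) = m + 1 + (L ! (i - 1)) (int j - (m + 1))" "u i j \<in> {1..n}"
      by (auto simp: u_def h m_def)
  qed
  have A: "int (A i j) = int (l + n * (i - 1)) + (m + 1) + (L ! (i - 1)) (int j - (m + 1))"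
    if "i \<in> {1..t}" for i j
    using u(1)[OF that] by (simp add: A_def)
  have inj: "inj_on (u i) {1..n}" if i: "i \<in> {1..t}" for i
  proof (rule inj_onI)
    fix j j' assume j: "j \<in> {1..n}" "j' \<in> {1..n}" and "u i j = u i j'"
    then have "(L ! (i - 1)) (int j - (m + 1)) = (L ! (i - 1)) (int j' - (m + 1))"
      using u(1)[OF i, of j] u(1)[OF i, of j'] by simp
    then have "[int j - (m + 1) = int j' - (m + 1)] (mod int n)"
      using row[OF i] unfolding is_row_def by blast
    \<comment> \<open>Indices in \<open>{1..n}\<close> are lowered by 1 to be least
      residues.\<close>
    then have "[int (j - 1) = int (j' - 1)] (mod int n)"
      using cong_add_rcancel[of "int j - (m + 1)" m "int j' - (m + 1)" "int n"] j by (simp add: of_nat_diff)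
    then have "j - 1 = j' - 1"
      using j by (intro cong_less_modulus_unique_nat[of _ _ n]) (auto simp: cong_int_iff)
    then show "j = j'" using j by auto
  qed
  have bij: "bij_betw (\<lambda>(i, j). A i j) ({1..t} \<times> {1..n}) {1 + l..n * t + l}"
    unfolding A_def using u(2) inj by (intro bij_betw_row_blocks) auto
  \<comment> \<open>The contribution of the block offsets and the centring, common to columns and
    diagonals; the rows of \<open>L\<close> add 0.\<close>
  define s where "s = (\<Sum>i = 1..t. int (l + n * (i - 1)) + (m + 1))"
  have shift: "(\<Sum>i = 1..t. g (i - 1)) = (\<Sum>i<t. g i)" for g :: "nat \<Rightarrow> int"
    by (rule sum.reindex_bij_witness[where i = Suc and j = "\<lambda>i. i - 1"]) auto
  have column: "int (column_sum t A j) = s" for j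
  proof -
    have "int (column_sum t A j) = s + (\<Sum>i = 1..t. (L ! (i - 1)) (int j - (m + 1)))"
      by (simp add: column_sum_def A s_def sum.distrib)
    also have "(\<Sum>i = 1..t. (L ! (i - 1)) (int j - (m + 1))) = list_column_sum L (int j - (m + 1))"
      by (simp only: list_column_sum_conv_sum len shift[of "\<lambda>i. (L ! i) (int j - (m + 1))"])
    finally show ?thesis using L by (simp add: solution_def)
  qed
  have diagonal: "int (forward_diagonal_sum t n A j) = s" for j
  proof -
    \<comment> \<open>Diagonal \<open>j\<close> meets the first row in column \<open>j + 1\<close>,
      whose centred index is \<open>j + 1 - (m + 1)\<close>.\<close>
    define k where "k = int j - m"
    have "(L ! (i - 1)) (int (pos_residue (int j + int i) n) - (m + 1)) = (L ! (i - 1)) (k + int (i - 1))"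
      if i: "i \<in> {1..t}" for i
    proof -
      have "[int (pos_residue (int j + int i) n) - (m + 1) = int j + int i - (m + 1)] (mod int n)"
        using \<open>n \<ge> 3\<close> by (intro cong_diff pos_residue_props) auto
      moreover have "int j + int i - (m + 1) = k + int (i - 1)" using i by (simp add: k_def)
      ultimately show ?thesis using row[OF i] by (simp add: is_row_def)
    qed
    then have "int (forward_diagonal_sum t n A j) = s + (\<Sum>i = 1..t. (L ! (i - 1)) (k + int (i - 1)))"
      by (simp add: forward_diagonal_sum_def A s_def sum.distrib)
    also have "(\<Sum>i = 1..t. (L ! (i - 1)) (k + int (i - 1))) = list_diagonal_sum L k"
      by (simp only: list_diagonal_sum_conv_sum len shift[of "\<lambda>i. (L ! i) (k + int i)"])
    finally show ?thesis using L by (simp add: solution_def)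
  qed
  have symmetric: "A i j + A (t + 1 - i) (n + 1 - j) = 2 * l + n * (t - 1) + n + 1"
    if i: "i \<in> {1..t}" and j: "j \<in> {1..n}" for i j
  proof -
    have i': "t + 1 - i \<in> {1..t}" using i by auto
    \<comment> \<open>The centred values at opposite cells cancel by reflection; the offsets of
      their blocks add up to \<open>n * (t - 1)\<close>.\<close>
    have "L ! (t + 1 - i - 1) = rev L ! (i - 1)"
      using i len rev_nth[of "i - 1" L] by auto
    also have "\<dots> = reflect (L ! (i - 1))"
    proof -
      have "rev L = map reflect L" using L by (simp add: solution_def)
      then show ?thesis using i len by auto
    qed
    finally have "(L ! (t + 1 - i - 1)) (int (n + 1 - j) - (m + 1))
        = - (L ! (i - 1)) (- (int (n + 1 - j) - (m + 1)))"
      by (simp add: reflect_def)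
    also have "- (int (n + 1 - j) - (m + 1)) = int j - (m + 1)"
      using j h by (simp add: m_def of_nat_diff)
    finally have "int (A i j + A (t + 1 - i) (n + 1 - j))
        = int (2 * l + n * ((i - 1) + (t + 1 - i - 1))) + 2 * (m + 1)"
      using A[OF i, of j] A[OF i', of "n + 1 - j"] by (simp add: distrib_left)
    also have "(i - 1) + (t + 1 - i - 1) = t - 1" using i by auto
    also have "int (2 * l + n * (t - 1)) + 2 * (m + 1) = int (2 * l + n * (t - 1) + n + 1)"
      by (simp add: m_def h)
    finally show ?thesis by (simp only: of_nat_eq_iff)
  qed
  have "SFD t n A"
    unfolding SFD_def
  proof (intro conjI)
    show "\<exists>s. \<forall>j\<in>{1..n}. column_sum t A j = s"
      using column by (metis of_nat_eq_iff)
    show "\<exists>s. \<forall>j\<in>{1..n}. forward_diagonal_sum t n A j = s"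
      using diagonal by (metis of_nat_eq_iff)
  qed (use \<open>t \<le> n\<close> bij symmetric in blast)+
  moreover have "entries t n A = {1 + l..n * t + l}"
  proof -
    have "entries t n A = (\<lambda>(i, j). A i j) ` ({1..t} \<times> {1..n})"
      unfolding entries_def by fastforce
    then show ?thesis using bij by (simp add: bij_betw_def)
  qed
  ultimately show ?thesis by blast
qed

end
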